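(* Let $\alpha\in(0,1)$. Let $F^*$ be a probability distribution on $\mathbb{R}$ that admits a Lebesgue density and for which there are numbers $a<b$ and $\varepsilon>0$ such that $\mathrm{SI}_\alpha(F^* )=[a,b]$ (that is, $[a,b]$ is the unique element of $\mathrm{SI}_\alpha(F^* )$), $F^*(b)=F^*(b+\varepsilon)$, and for every $\beta\in(0,\alpha)$, \[ \operatorname{len}(\mathrm{SI}_\beta(F^* ))>\operatorname{len}(\mathrm{SI}_\alpha(F^* ))+\tfrac12\varepsilon . \] If $\mathcal{F}$ is a class of probability distributions on $\mathbb{R}$ that contains the location-scale family of $F^*$ along with its finite mixtures, then the shortest interval functional $\mathrm{SI}_\alpha$ is not elicitable relative to $\mathcal{F}$.
   Context: The observation domain is $\mathbb{R}$ and the action domain is $\mathsf{A}=\{[a,b] : a,b\in\mathbb{R},\ a\le b\}$. Probability distributions are identified with their CDFs, and $F(a-)=\lim_{y\uparrow a}F(y)$. For $\beta\in(0,1)$ the shortest interval functional at level $\beta$ is \[ \mathrm{SI}_\beta(F)=\arg\min_{[a,b]\in\mathsf{A}}\{\,b-a : F(b)-F(a-)\ge 1-\beta\,\}\subseteq\mathsf{A}, \] and $\operatorname{len}(\mathrm{SI}_\beta(F))$ denotes the common length of all intervals in $\mathrm{SI}_\beta(F)$. The location-scale family of $F^*$ consists of all CDFs $x\mapsto F^*((x-\mu)/\sigma)$ with $\mu\in\mathbb{R}$, $\sigma>0$; its finite mixtures are the finite convex combinations of its members. A scoring function is a map $S:\mathsf{A}\times\mathbb{R}\to\mathbb{R}$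 such that for all $x\in\mathsf{A}$ the function $S(x,\cdot)$ is measurable and $\mathbb{E}_F S(x,Y)$ (with $Y\sim F$) is well-defined and finite for all $F\in\mathcal{F}$. For a functional $T:\mathcal{F}\to 2^{\mathsf{A}}$, $S$ is strictly consistent relative to $\mathcal{F}$ if $\mathbb{E}_F S(t,Y)\le\mathbb{E}_F S(x,Y)$ for all $F\in\mathcal{F}$, $t\in T(F)$, $x\in\mathsf{A}$, with equality only if $x\in T(F)$. $T$ is elicitable relative to $\mathcal{F}$ if there exists a scoring function that is strictly consistent for $T$ relative to $\mathcal{F}$. *)

theory Defs
  imports "HOL-Probability.Probability"
begin

text \<open>
  A probability distribution on the real line is a measure satisfying \<open>real_distribution\<close>; its CDF
  is the library constant \<open>cdf\<close>, and a distribution is determined by its CDF (\<open>cdf_unique\<close>).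
\<close>

definition intervals :: "real set set" where
  "intervals = {{a..b} | a b. a \<le> b}"

definition cdf_left :: "real measure \<Rightarrow> real \<Rightarrow> real" where
  "cdf_left F a = Lim (at_left a) (cdf F)"

definition covers :: "real \<Rightarrow> real measure \<Rightarrow> real \<Rightarrow> real \<Rightarrow> bool" where
  "covers \<beta> F a b \<longleftrightarrow> cdf F b - cdf_left F a \<ge> 1 - \<beta>"

definition SI :: "real \<Rightarrow> real measure \<Rightarrow> real set set" where
  "SI \<beta> F = {{a..b} | a b. a \<le> b \<and> covers \<beta> F a b \<and>
                (\<forall>c d. c \<le> d \<and> covers \<beta> F c d \<longrightarrow> b - a \<le> d - c)}"

text \<open>
  The common length of the intervals in a set of intervals; meaningful only if the set is nonempty
  and its members have equal length. For a distribution \<open>F\<close> and \<open>0 < \<beta> < 1\<close> the set \<open>SI \<beta> F\<close> is of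
  this kind: the minimum is attained.
\<close>

definition len :: "real set set \<Rightarrow> real" where
  "len T = (THE l. \<exists>a b. a \<le> b \<and> {a..b} \<in> T \<and> l = b - a)"

lemma len_SI:
  assumes "a \<le> b" "{a..b} \<in> SI \<beta> F"
  shows "len (SI \<beta> F) = b - a"
  unfolding len_def
proof (rule the_equality)
  show "\<exists>a' b'. a' \<le> b' \<and> {a'..b'} \<in> SI \<beta> F \<and> b - a = b' - a'"
    using assms by blast
next
  have min: "covers \<beta> F c d \<and> (\<forall>c' d'. c' \<le> d' \<and> covers \<beta> F c' d' \<longrightarrow> d - c \<le> d' - c')"
    if "c \<le> d" "{c..d} \<in> SI \<beta> F" for c d
    using that unfolding SI_def by (auto simp: Icc_eq_Icc)
  show "l = b - a" if "\<exists>a' b'. a' \<le> b' \<and> {a'..b'} \<in> SI \<beta> F \<and> l = b' - a'" for l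
    using that min assms by (metis order_antisym)
qed

definition location_scale_family :: "real measure \<Rightarrow> real measure set" where
  "location_scale_family F =
     {G. real_distribution G \<and>
         (\<exists>\<mu> \<sigma>. \<sigma> > 0 \<and> (\<forall>x. cdf G x = cdf F ((x - \<mu>) / \<sigma>)))}"

definition finite_mixtures :: "real measure set \<Rightarrow> real measure set" where
  "finite_mixtures L =
     {G. real_distribution G \<and>
         (\<exists>(n::nat) p H. (\<forall>i<n. p i \<ge> 0 \<and> H i \<in> L) \<and> (\<Sum>i<n. p i) = 1 \<and>
            (\<forall>x. cdf G x = (\<Sum>i<n. p i * cdf (H i) x)))}"

text \<open>
  \<open>A\<close> is the action domain. Functions are total in HOL: the values of \<open>S\<close> outside \<open>A\<close> and of a
  functional \<open>T\<close> outside \<open>\<F>\<close> play no role.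
\<close>

definition scoring_function ::
    "'a set \<Rightarrow> real measure set \<Rightarrow> ('a \<Rightarrow> real \<Rightarrow> real) \<Rightarrow> bool" where
  "scoring_function A \<F> S \<longleftrightarrow>
     (\<forall>x\<in>A. S x \<in> borel_measurable borel \<and> (\<forall>F\<in>\<F>. integrable F (S x)))"

definition strictly_consistent ::
    "'a set \<Rightarrow> real measure set \<Rightarrow> ('a \<Rightarrow> real \<Rightarrow> real) \<Rightarrow> (real measure \<Rightarrow> 'a set) \<Rightarrow> bool" where
  "strictly_consistent A \<F> S T \<longleftrightarrow>
     (\<forall>F\<in>\<F>. \<forall>t\<in>T F. \<forall>x\<in>A.
        (LINT y|F. S t y) \<le> (LINT y|F. S x y) \<and>
        ((LINT y|F. S t y) = (LINT y|F. S x y) \<longrightarrow> x \<in> T F))"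

definition elicitable ::
    "'a set \<Rightarrow> real measure set \<Rightarrow> (real measure \<Rightarrow> 'a set) \<Rightarrow> bool" where
  "elicitable A \<F> T \<longleftrightarrow> (\<exists>S. scoring_function A \<F> S \<and> strictly_consistent A \<F> S T)"

end

theory Submission
  imports Defs
begin

text \<open>
  Put \<open>\<mu> = \<epsilon>/2\<close> and let \<open>F\<^sub>0 = F*\<close> and \<open>F\<^sub>1\<close> be its translate by \<open>\<mu>\<close>. By the assumption on
  smaller levels no interval of length at most \<open>(b - a) + \<mu>\<close> has mass above \<open>1 - \<alpha>\<close> under \<open>F\<^sub>0\<close>
  or \<open>F\<^sub>1\<close>. Hence such an interval has mass \<open>1 - \<alpha>\<close> under a proper mixture
  \<open>(1 - w) F\<^sub>0 + w F\<^sub>1\<close> iff it has mass \<open>1 - \<alpha>\<close> under both components. The interval \<open>[a, b + \<mu>]\<close> is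
  of this kind, because \<open>F*\<close> has no mass between \<open>b\<close> and \<open>b + \<epsilon>\<close>. So \<open>SI\<^sub>\<alpha>\<close> takes one and the
  same value on all these mixtures, and no element \<open>t\<close> of it is \<open>[a, b]\<close>. As expected scores are
  affine in \<open>w\<close>, letting \<open>w \<rightarrow> 0\<close> shows that \<open>t\<close> is also optimal under \<open>F\<^sub>0\<close>, which contradicts
  strict consistency.
\<close>

section \<open>Shortest intervals of continuous distributions\<close>

lemma covers_continuous_iff:
  assumes "\<And>x. isCont (cdf F) x"
  shows "covers \<beta> F c d \<longleftrightarrow> cdf F d - cdf F c \<ge> 1 - \<beta>"
proof -
  have "(cdf F \<longlongrightarrow> cdf F c) (at_left c)"
    using assms[of c] by (simp add: isCont_def filterlim_at_split)
  hence "cdf_left F c = cdf F c"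
    unfolding cdf_left_def by (intro tendsto_Lim) auto
  thus ?thesis by (simp add: covers_def)
qed

lemma mem_SI_iff:
  assumes "c \<le> d"
  shows "{c..d} \<in> SI \<beta> F \<longleftrightarrow>
    covers \<beta> F c d \<and> (\<forall>c' d'. c' \<le> d' \<and> covers \<beta> F c' d' \<longrightarrow> d - c \<le> d' - c')"
  using assms unfolding SI_def by (auto simp: Icc_eq_Icc)

text \<open>A compactness argument: the pairs of endpoints with enough mass and length at most that
  of one fixed admissible interval form a compact set, on which the length attains its
  minimum.\<close>

lemma SI_nonempty:
  assumes "real_distribution F" and cont: "\<And>x. isCont (cdf F) x" and "0 < \<beta>" "\<beta> < 1"
  obtains c d where "c \<le> d" "{c..d} \<in> SI \<beta> F"
proof -
  interpret real_distribution F by fact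
  note cov = covers_continuous_iff[OF cont]
  have "eventually (\<lambda>x. cdf F x > 1 - \<beta> / 2) at_top"
    using order_tendstoD(1)[OF cdf_lim_at_top_prob, of "1 - \<beta> / 2"] \<open>0 < \<beta>\<close> by simp
  then obtain d0 where d0: "\<And>x. x \<ge> d0 \<Longrightarrow> cdf F x > 1 - \<beta> / 2"
    by (auto simp: eventually_at_top_linorder)
  \<comment> \<open>The bound \<open>\<beta> / 2\<close> serves to build one admissible interval;
    the bound \<open>1 - \<beta>\<close> keeps the right endpoint of every admissible interval above
    \<open>c0\<close>.\<close>
  have "eventually (\<lambda>x. cdf F x < min (\<beta> / 2) (1 - \<beta>)) at_bot"
    using order_tendstoD(2)[OF cdf_lim_at_bot, of "min (\<beta> / 2) (1 - \<beta>)"] \<open>0 < \<beta>\<close> \<open>\<beta> < 1\<close> by simp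
  then obtain c0 where c0: "\<And>x. x \<le> c0 \<Longrightarrow> cdf F x < min (\<beta> / 2) (1 - \<beta>)"
    by (auto simp: eventually_at_bot_linorder)
  \<comment> \<open>To the right of \<open>e0\<close> less than \<open>1 - \<beta>\<close> of the
    mass is left, so every left endpoint lies below \<open>e0\<close>.\<close>
  have "eventually (\<lambda>x. cdf F x > \<beta>) at_top"
    using order_tendstoD(1)[OF cdf_lim_at_top_prob, of \<beta>] \<open>\<beta> < 1\<close> by simp
  then obtain e0 where e0: "\<And>x. x \<ge> e0 \<Longrightarrow> cdf F x > \<beta>"
    by (auto simp: eventually_at_top_linorder)
  \<comment> \<open>Taking \<open>min\<close> and \<open>max\<close> avoids having to order
    \<open>c0\<close> and \<open>d0\<close>, which come from separate limits.\<close>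
  define c1 d1 where "c1 = min c0 d0" and "d1 = max c0 d0"
  define l where "l = d1 - c1"
  have cd1: "c1 \<le> d1" "cdf F d1 - cdf F c1 \<ge> 1 - \<beta>"
    using d0[of d1] c0[of c1] by (auto simp: c1_def d1_def)
  define K where "K = {p. fst p \<le> snd p \<and> cdf F (snd p) - cdf F (fst p) \<ge> 1 - \<beta> \<and> snd p - fst p \<le> l}"
  have contF: "continuous_on UNIV (\<lambda>x. cdf F x)"
    using cont by (simp add: continuous_at_imp_continuous_on)
  have "closed K"
    unfolding K_def
    by (intro closed_Collect_conj closed_Collect_le continuous_intros
        continuous_on_compose2[OF contF]) auto
  moreover have "K \<subseteq> {c0 - l..e0} \<times> {c0..e0 + l}"
  proof
    fix p assume p: "p \<in> K"
    have "\<not> snd p \<le> c0"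
      using p c0[of "snd p"] cdf_nonneg[of "fst p"] by (auto simp: K_def)
    moreover have "\<not> fst p \<ge> e0"
      using p e0[of "fst p"] cdf_bounded_prob[of "snd p"] by (auto simp: K_def)
    ultimately show "p \<in> {c0 - l..e0} \<times> {c0..e0 + l}"
      using p by (auto simp: K_def mem_Times_iff)
  qed
  ultimately have "compact K"
    by (metis bounded_subset bounded_Times bounded_closed_interval compact_eq_bounded_closed)
  moreover have "(c1, d1) \<in> K"
    using cd1 by (simp add: K_def l_def)
  moreover have "continuous_on K (\<lambda>p. snd p - fst p)"
    by (intro continuous_intros)
  ultimately obtain p where p: "p \<in> K" "\<And>q. q \<in> K \<Longrightarrow> snd p - fst p \<le> snd q - fst q"
    using continuous_attains_inf[of K "\<lambda>p. snd p - fst p"] by blast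
  \<comment> \<open>Competitors longer than \<open>l\<close> are outside \<open>K\<close>, but
    \<open>p\<close> itself has length at most \<open>l\<close>.\<close>
  have "snd p - fst p \<le> d' - c'" if "c' \<le> d'" "covers \<beta> F c' d'" for c' d'
    using p(1) p(2)[of "(c', d')"] that by (cases "d' - c' \<le> l") (auto simp: K_def cov)
  hence "{fst p..snd p} \<in> SI \<beta> F"
    using p(1) by (auto simp: mem_SI_iff cov K_def)
  with p(1) that show thesis by (auto simp: K_def)
qed

text \<open>An interval with mass above \<open>1 - \<alpha>\<close> would still be admissible at
  some level below \<alpha>, so the shortest interval at that level could not be longer than
  it.\<close>

lemma cdf_diff_le_of_len_SI_greater:
  assumes "real_distribution F" "\<And>x. isCont (cdf F) x" "c \<le> d" "0 < \<alpha>" "\<alpha> < 1"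
    and long: "\<And>\<beta>. 0 < \<beta> \<Longrightarrow> \<beta> < \<alpha> \<Longrightarrow> len (SI \<beta> F) > d - c"
  shows "cdf F d - cdf F c \<le> 1 - \<alpha>"
proof (rule ccontr)
  interpret real_distribution F by fact
  assume less: "\<not> ?thesis"
  \<comment> \<open>The midpoint of \<alpha> and the mass outside the interval is positive even when
    that mass is 0.\<close>
  define \<beta> where "\<beta> = (\<alpha> + (1 - (cdf F d - cdf F c))) / 2"
  have "cdf F d - cdf F c \<le> 1"
    using cdf_bounded_prob[of d] cdf_nonneg[of c] by linarith
  hence \<beta>: "0 < \<beta>" "\<beta> < \<alpha>" "covers \<beta> F c d"
    using less assms(4) by (auto simp: \<beta>_def covers_continuous_iff[OF assms(2)] field_simps)
  obtain u v where uv: "u \<le> v" "{u..v} \<in> SI \<beta> F"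
    using SI_nonempty[OF assms(1,2), of \<beta>] \<beta> assms(5) by (metis less_trans)
  have "v - u \<le> d - c"
    using uv \<beta>(3) assms(3) by (simp add: mem_SI_iff)
  thus False using long[OF \<beta>(1,2)] len_SI[OF uv] by simp
qed

section \<open>Mixtures and translates of densities\<close>

lemma nn_integral_density_mixture:
  fixes f g :: "'a \<Rightarrow> ennreal"
  assumes [measurable]: "f \<in> borel_measurable M" "g \<in> borel_measurable M" "h \<in> borel_measurable M"
  shows "(\<integral>\<^sup>+x. h x \<partial>density M (\<lambda>x. u * f x + v * g x)) =
    u * (\<integral>\<^sup>+x. h x \<partial>density M f) + v * (\<integral>\<^sup>+x. h x \<partial>density M g)"
  by (simp add: nn_integral_density distrib_right nn_integral_add nn_integral_cmult mult.assoc)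

text \<open>Makes expected scores affine in the mixture weight. The nonnegative case is applied to
  the positive and the negative part; integrability under both components keeps all terms finite, as
  \<open>enn2real\<close> requires to be additive.\<close>

lemma integral_density_mixture:
  fixes f g :: "'a \<Rightarrow> ennreal" and h :: "'a \<Rightarrow> real"
  assumes [measurable]: "f \<in> borel_measurable M" "g \<in> borel_measurable M" "h \<in> borel_measurable M"
    and uv: "u \<ge> 0" "v \<ge> 0"
    and int: "integrable (density M f) h" "integrable (density M g) h"
  shows "(LINT x|density M (\<lambda>x. ennreal u * f x + ennreal v * g x). h x) =
    u * (LINT x|density M f. h x) + v * (LINT x|density M g. h x)"
proof -
  let ?D = "density M (\<lambda>x. ennreal u * f x + ennreal v * g x)"
  have fin: "(\<integral>\<^sup>+x. ennreal (h x) \<partial>density M f) < \<infinity>" "(\<integral>\<^sup>+x. ennreal (- h x) \<partial>density M f) < \<infinity>"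
    "(\<integral>\<^sup>+x. ennreal (h x) \<partial>density M g) < \<infinity>" "(\<integral>\<^sup>+x. ennreal (- h x) \<partial>density M g) < \<infinity>"
    using int by (auto simp: real_integrable_def less_top)
  have nn: "(\<integral>\<^sup>+x. ennreal (k x) \<partial>?D) = ennreal u * (\<integral>\<^sup>+x. ennreal (k x) \<partial>density M f)
      + ennreal v * (\<integral>\<^sup>+x. ennreal (k x) \<partial>density M g)"
    if [measurable]: "k \<in> borel_measurable M" for k :: "'a \<Rightarrow> real"
    by (rule nn_integral_density_mixture) measurable
  have intD: "integrable ?D h"
    unfolding real_integrable_def nn[OF assms(3)] nn[OF borel_measurable_uminus[OF assms(3)]]
    using fin by (simp add: ennreal_mult_eq_top_iff less_top)
  have split: "enn2real (ennreal u * p + ennreal v * q) = u * enn2real p + v * enn2real q"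
    if "p < \<infinity>" "q < \<infinity>" for p q
    using that uv
    by (simp add: enn2real_plus ennreal_mult_less_top enn2real_mult)
  show ?thesis
    unfolding real_lebesgue_integral_def[OF intD] real_lebesgue_integral_def[OF int(1)]
      real_lebesgue_integral_def[OF int(2)] nn[OF assms(3)] nn[OF borel_measurable_uminus[OF assms(3)]]
      split[OF fin(1,3)] split[OF fin(2,4)]
    by (simp add: algebra_simps)
qed

lemma measure_density_mixture:
  fixes f g :: "'a \<Rightarrow> ennreal"
  assumes [measurable]: "f \<in> borel_measurable M" "g \<in> borel_measurable M" "A \<in> sets M"
    and "u \<ge> 0" "v \<ge> 0" "finite_measure (density M f)" "finite_measure (density M g)"
  shows "measure (density M (\<lambda>x. ennreal u * f x + ennreal v * g x)) A =
    u * measure (density M f) A + v * measure (density M g) A"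
proof -
  have "emeasure (density M (\<lambda>x. ennreal u * f x + ennreal v * g x)) A =
      ennreal u * emeasure (density M f) A + ennreal v * emeasure (density M g) A"
    using nn_integral_density_mixture[of f M g "indicator A" "ennreal u" "ennreal v"] by simp
  also have "\<dots> = ennreal (u * measure (density M f) A + v * measure (density M g) A)"
    using assms(4-7) by (simp add: finite_measure.emeasure_eq_measure ennreal_mult ennreal_plus)
  finally show ?thesis
    using assms(4,5) by (intro measure_eq_emeasure_eq_ennreal) auto
qed

lemma real_distribution_density_mixture:
  fixes f g :: "real \<Rightarrow> ennreal"
  assumes [measurable]: "f \<in> borel_measurable lborel" "g \<in> borel_measurable lborel"
    and "real_distribution (density lborel f)" "real_distribution (density lborel g)"
    and "u \<ge> 0" "v \<ge> 0" "u + v = 1"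
  shows "real_distribution (density lborel (\<lambda>x. ennreal u * f x + ennreal v * g x))"
proof -
  interpret F: real_distribution "density lborel f" by fact
  interpret G: real_distribution "density lborel g" by fact
  have "measure (density lborel (\<lambda>x. ennreal u * f x + ennreal v * g x)) UNIV = 1"
    using measure_density_mixture[of f lborel g UNIV u v] assms(5-7) F.prob_space G.prob_space
      F.finite_measure_axioms G.finite_measure_axioms by simp
  \<comment> \<open>Infinite total mass is excluded because \<open>measure\<close> would then be
    0.\<close>
  hence "emeasure (density lborel (\<lambda>x. ennreal u * f x + ennreal v * g x)) UNIV = 1"
    by (cases "emeasure (density lborel (\<lambda>x. ennreal u * f x + ennreal v * g x)) UNIV")
      (auto simp: measure_def)
  hence "prob_space (density lborel (\<lambda>x. ennreal u * f x + ennreal v * g x))"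
    by (intro prob_spaceI) simp
  thus ?thesis
    by (simp add: real_distribution_def real_distribution_axioms_def)
qed

text \<open>Translation invariance of Lebesgue measure. The density form enters the mixtures, the
  image measure form gives the CDF.\<close>

lemma density_translate:
  fixes f :: "real \<Rightarrow> ennreal"
  assumes [measurable]: "f \<in> borel_measurable lborel"
  shows "density lborel (\<lambda>x. f (x - \<mu>)) = distr (density lborel f) borel (\<lambda>x. x + \<mu>)"
proof (rule measure_eqI)
  fix A assume "A \<in> sets (density lborel (\<lambda>x. f (x - \<mu>)))"
  hence A [measurable]: "A \<in> sets borel" by simp
  have [measurable]: "(\<lambda>x. x + \<mu>) -` A \<in> sets borel"
    by (rule measurable_sets_borel[OF _ A]) measurable
  have "emeasure (density lborel (\<lambda>x. f (x - \<mu>))) A = (\<integral>\<^sup>+x. f (x - \<mu>) * indicator A x \<partial>lborel)"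
    by (simp add: emeasure_density)
  also have "\<dots> = (\<integral>\<^sup>+x. f x * indicator A (x + \<mu>) \<partial>lborel)"
    using nn_integral_real_affine[of "\<lambda>x. f (x - \<mu>) * indicator A x" 1 \<mu>]
    by (simp add: add.commute)
  also have "\<dots> = (\<integral>\<^sup>+x. f x * indicator ((\<lambda>x. x + \<mu>) -` A) x \<partial>lborel)"
    by (intro nn_integral_cong) (simp add: indicator_def)
  also have "\<dots> = emeasure (distr (density lborel f) borel (\<lambda>x. x + \<mu>)) A"
    by (simp add: emeasure_distr emeasure_density)
  finally show "emeasure (density lborel (\<lambda>x. f (x - \<mu>))) A =
    emeasure (distr (density lborel f) borel (\<lambda>x. x + \<mu>)) A" .
qed simp

lemma real_distribution_translate:
  assumes "real_distribution F"
  shows "real_distribution (distr F borel (\<lambda>x. x + \<mu>))"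
proof -
  interpret real_distribution F by fact
  show ?thesis by (rule real_distribution_distr) simp
qed

lemma cdf_translate:
  assumes "real_distribution F"
  shows "cdf (distr F borel (\<lambda>x. x + \<mu>)) x = cdf F (x - \<mu>)"
proof -
  interpret real_distribution F by fact
  have "(\<lambda>y. y + \<mu>) -` {..x} = {..x - \<mu>}" by auto
  thus ?thesis by (simp add: cdf_def measure_distr)
qed

lemma isCont_cdf_density:
  assumes "f \<in> borel_measurable lborel" "real_distribution (density lborel f)"
  shows "isCont (cdf (density lborel f)) x"
proof -
  interpret real_distribution "density lborel f" by fact
  have "absolutely_continuous lborel (density lborel f)"
    using assms(1) by (rule absolutely_continuousI_density)
  hence "{x} \<in> null_sets (density lborel f)"
    unfolding absolutely_continuous_def by (rule subsetD) (simp add: finite_imp_null_set_lborel)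
  thus ?thesis by (simp add: isCont_cdf measure_eq_0_null_sets)
qed

section \<open>Non-elicitability\<close>

theorem theorem3p8:
  fixes \<alpha> a b \<epsilon> :: real
    and Fs :: "real measure"
    and \<F> :: "real measure set"
  assumes "0 < \<alpha>" and "\<alpha> < 1"
    and "real_distribution Fs"
    and "\<exists>f :: real \<Rightarrow> ennreal. f \<in> borel_measurable lborel \<and> Fs = density lborel f"
    and "a < b" and "0 < \<epsilon>"
    and "SI \<alpha> Fs = {{a..b}}"
    and "cdf Fs b = cdf Fs (b + \<epsilon>)"
    and "\<And>\<beta>. 0 < \<beta> \<Longrightarrow> \<beta> < \<alpha> \<Longrightarrow> len (SI \<beta> Fs) > len (SI \<alpha> Fs) + \<epsilon> / 2"
    and "\<And>F. F \<in> \<F> \<Longrightarrow> real_distribution F"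
    and "location_scale_family Fs \<subseteq> \<F>"
    and "finite_mixtures (location_scale_family Fs) \<subseteq> \<F>"
  shows "\<not> elicitable intervals \<F> (SI \<alpha>)"
proof
  assume "elicitable intervals \<F> (SI \<alpha>)"
  then obtain S where scor: "scoring_function intervals \<F> S"
    and cons: "strictly_consistent intervals \<F> S (SI \<alpha>)"
    unfolding elicitable_def by blast
  obtain f :: "real \<Rightarrow> ennreal"
    where f [measurable]: "f \<in> borel_measurable lborel" and Fs: "Fs = density lborel f"
    using assms(4) by blast
  interpret Fs: real_distribution Fs by fact
  have contF: "isCont (cdf Fs) x" for x
    using isCont_cdf_density[OF f] assms(3) Fs by simp
  \<comment> \<open>This is the slack in the length hypothesis, so \<open>[a, b + \<mu>]\<close> is
    just short enough for the bound \<open>le\<close> below.\<close>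
  define \<mu> where "\<mu> = \<epsilon> / 2"
  have \<mu>: "0 < \<mu>" "\<mu> < \<epsilon>" using \<open>0 < \<epsilon>\<close> by (auto simp: \<mu>_def)
  define g where "g = (\<lambda>x. f (x - \<mu>))"
  have g [measurable]: "g \<in> borel_measurable lborel" unfolding g_def by measurable
  define F1 where "F1 = density lborel g"
  have F1_distr: "F1 = distr Fs borel (\<lambda>x. x + \<mu>)"
    by (simp add: F1_def g_def Fs density_translate[OF f])
  have rF1: "real_distribution F1"
    using real_distribution_translate[OF assms(3)] F1_distr by simp
  have cdfF1: "cdf F1 x = cdf Fs (x - \<mu>)" for x
    using cdf_translate[OF assms(3)] F1_distr by simp
  define G where "G = (\<lambda>w. density lborel (\<lambda>x. ennreal (1 - w) * f x + ennreal w * g x))"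
  have rG: "real_distribution (G w)" if "0 < w" "w < 1" for w
    unfolding G_def using assms(3) rF1 that
    by (intro real_distribution_density_mixture[OF f g]) (simp_all add: Fs F1_def)
  have cdfG: "cdf (G w) x = (1 - w) * cdf Fs x + w * cdf F1 x" if "0 < w" "w < 1" for w x
    unfolding G_def cdf_def Fs F1_def
    using that Fs.finite_measure_axioms real_distribution.finite_borel_measure_M[OF rF1]
    by (intro measure_density_mixture[OF f g]) (auto simp: Fs F1_def finite_borel_measure_def)
  have contG: "isCont (cdf (G w)) x" if "0 < w" "w < 1" for w x
    using rG[OF that] unfolding G_def by (intro isCont_cdf_density) simp_all

  have F_mem: "Fs \<in> location_scale_family Fs" "F1 \<in> location_scale_family Fs"
  proof -
    have "\<forall>x. cdf Fs x = cdf Fs ((x - 0) / 1)" "\<forall>x. cdf F1 x = cdf Fs ((x - \<mu>) / 1)"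
      by (simp_all add: cdfF1)
    thus "Fs \<in> location_scale_family Fs" "F1 \<in> location_scale_family Fs"
      unfolding location_scale_family_def using assms(3) rF1 zero_less_one by blast+
  qed
  have G_mem: "G w \<in> \<F>" if "0 < w" "w < 1" for w
  proof -
    define p where "p = (\<lambda>i::nat. if i = 0 then 1 - w else w)"
    define H where "H = (\<lambda>i::nat. if i = 0 then Fs else F1)"
    have "(\<forall>i<2. p i \<ge> 0 \<and> H i \<in> location_scale_family Fs) \<and> (\<Sum>i<2. p i) = 1 \<and>
        (\<forall>x. cdf (G w) x = (\<Sum>i<2. p i * cdf (H i) x))"
      using that F_mem cdfG[OF that] by (simp add: p_def H_def numeral_2_eq_2)
    hence "G w \<in> finite_mixtures (location_scale_family Fs)"
      unfolding finite_mixtures_def using rG[OF that] by blast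
    thus ?thesis using assms(12) by blast
  qed

  have ab: "{a..b} \<in> SI \<alpha> Fs" using assms(7) by simp
  have lenab: "len (SI \<alpha> Fs) = b - a"
    using len_SI[OF _ ab] \<open>a < b\<close> by simp
  have covab: "cdf Fs b - cdf Fs a \<ge> 1 - \<alpha>"
    using ab \<open>a < b\<close> by (simp add: mem_SI_iff covers_continuous_iff[OF contF])
  have le: "cdf Fs d - cdf Fs c \<le> 1 - \<alpha>" if "c \<le> d" "d - c \<le> b - a + \<mu>" for c d
  proof (rule cdf_diff_le_of_len_SI_greater[OF assms(3) contF that(1) assms(1,2)])
    show "len (SI \<beta> Fs) > d - c" if "0 < \<beta>" "\<beta> < \<alpha>" for \<beta>
      using assms(9)[OF that] \<open>d - c \<le> b - a + \<mu>\<close> by (simp add: lenab \<mu>_def)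
  qed
  have le1: "cdf F1 d - cdf F1 c \<le> 1 - \<alpha>" if "c \<le> d" "d - c \<le> b - a + \<mu>" for c d
    using le[of "c - \<mu>" "d - \<mu>"] that by (simp add: cdfF1)
  have covG: "covers \<alpha> (G w) c d \<longleftrightarrow>
      cdf Fs d - cdf Fs c \<ge> 1 - \<alpha> \<and> cdf F1 d - cdf F1 c \<ge> 1 - \<alpha>" (is "_ \<longleftrightarrow> ?R")
    if "0 < w" "w < 1" "c \<le> d" "d - c \<le> b - a + \<mu>" for w c d
  proof -
    \<comment> \<open>The shortfalls from \<open>1 - \<alpha>\<close> under the two components. Both
      are nonnegative, so a combination with positive weights is at most 0 only if both vanish, a
      condition free of \<open>w\<close>.\<close>
    define p q where "p = 1 - \<alpha> - (cdf Fs d - cdf Fs c)" and "q = 1 - \<alpha> - (cdf F1 d - cdf F1 c)"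
    have pq: "p \<ge> 0" "q \<ge> 0"
      using le[OF that(3,4)] le1[OF that(3,4)] by (auto simp: p_def q_def)
    have "covers \<alpha> (G w) c d \<longleftrightarrow> (1 - w) * p + w * q \<le> 0"
      by (simp add: covers_continuous_iff[OF contG[OF that(1,2)]] cdfG[OF that(1,2)] p_def q_def
          algebra_simps)
    also have "\<dots> \<longleftrightarrow> p = 0 \<and> q = 0"
    proof -
      have "(1 - w) * p \<ge> 0" "w * q \<ge> 0" using pq that(1,2) by simp_all
      hence "(1 - w) * p + w * q \<le> 0 \<longleftrightarrow> (1 - w) * p = 0 \<and> w * q = 0" by linarith
      thus ?thesis using that(1,2) by simp
    qed
    also have "\<dots> \<longleftrightarrow> ?R" using pq by (auto simp: p_def q_def)
    finally show ?thesis .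
  qed

  have half: "0 < (1/2::real)" "(1/2::real) < 1" by simp_all
  \<comment> \<open>The weight \<open>1/2\<close> is only a reference point; \<open>in_SI\<close>
    transfers the minimiser to all weights.\<close>
  obtain c d where cd: "c \<le> d" "{c..d} \<in> SI \<alpha> (G (1/2))"
    using SI_nonempty[OF rG contG assms(1,2), OF half half] by blast
  \<comment> \<open>\<open>[a, b + \<mu>]\<close> contains both \<open>[a, b]\<close> and its
    translate by \<mu>. It therefore bounds the length of the minimiser, which brings
    \<open>[c, d]\<close> into the range of \<open>covG\<close>.\<close>
  have "cdf Fs (b + \<mu>) \<ge> cdf Fs b" "cdf Fs a \<ge> cdf Fs (a - \<mu>)"
    using \<mu> by (auto intro!: Fs.cdf_nondecreasing)
  hence "covers \<alpha> (G (1/2)) a (b + \<mu>)"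
    using covG[OF half, of a "b + \<mu>"] covab \<open>a < b\<close> \<mu> by (simp add: cdfF1)
  hence short: "d - c \<le> b - a + \<mu>"
    using cd(2) \<open>a < b\<close> \<mu>(1) unfolding mem_SI_iff[OF cd(1)]
    by (smt (verit))
  have covcd: "cdf Fs d - cdf Fs c \<ge> 1 - \<alpha>" "cdf F1 d - cdf F1 c \<ge> 1 - \<alpha>"
    using covG[OF half cd(1) short] cd by (auto simp: mem_SI_iff)

  have in_SI: "{c..d} \<in> SI \<alpha> (G w)" if w: "0 < w" "w < 1" for w
    unfolding mem_SI_iff[OF cd(1)]
  proof (intro conjI allI impI)
    show "covers \<alpha> (G w) c d" using covG[OF w cd(1) short] covcd by simp
  next
    fix c' d' assume *: "c' \<le> d' \<and> covers \<alpha> (G w) c' d'"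
    show "d - c \<le> d' - c'"
    proof (cases "d' - c' \<le> b - a + \<mu>")
      case True
      hence "covers \<alpha> (G (1/2)) c' d'"
        using * covG[OF w, of c' d'] covG[OF half, of c' d'] by simp
      thus ?thesis using cd * by (simp add: mem_SI_iff)
    qed (use short in simp)
  qed

  have not_ab: "{c..d} \<noteq> {a..b}"
  proof
    assume "{c..d} = {a..b}"
    hence "c = a" "d = b" using cd(1) \<open>a < b\<close> by (auto simp: Icc_eq_Icc)
    \<comment> \<open>Mass under \<open>F1\<close> is mass of the interval shifted back under
      \<open>Fs\<close>; this yields a second shortest interval of \<open>Fs\<close>, against
      uniqueness.\<close>
    hence "covers \<alpha> Fs (a - \<mu>) (b - \<mu>)"
      using covcd(2) by (simp add: cdfF1 covers_continuous_iff[OF contF])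
    hence "{a - \<mu>..b - \<mu>} \<in> SI \<alpha> Fs"
      using ab \<open>a < b\<close> by (simp add: mem_SI_iff)
    thus False using assms(7) \<open>a < b\<close> \<mu> by (simp add: Icc_eq_Icc)
  qed

  have ivl: "{a..b} \<in> intervals" "{c..d} \<in> intervals"
    using \<open>a < b\<close> cd(1) by (auto simp: intervals_def)
  have F_mem': "Fs \<in> \<F>" "F1 \<in> \<F>" using F_mem assms(11) by auto
  have LG: "(LINT y|G w. S x y) = (1 - w) * (LINT y|Fs. S x y) + w * (LINT y|F1. S x y)"
    if "0 < w" "w < 1" "x \<in> intervals" for w x
    unfolding G_def Fs F1_def using scor F_mem' that
    by (intro integral_density_mixture[OF f g]) (auto simp: scoring_function_def Fs F1_def)
  \<comment> \<open>For \<open>0 < w < 1\<close> these are the expected scores of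
    \<open>[a, b]\<close> and \<open>[c, d]\<close> under \<open>G w\<close>; at 0 they are those
    under \<open>Fs\<close>.\<close>
  define P where "P = (\<lambda>w. (1 - w) * (LINT y|Fs. S {a..b} y) + w * (LINT y|F1. S {a..b} y))"
  define Q where "Q = (\<lambda>w. (1 - w) * (LINT y|Fs. S {c..d} y) + w * (LINT y|F1. S {c..d} y))"
  have "eventually (\<lambda>w. Q w \<le> P w) (at_right 0)"
    using eventually_at_right_less[of "0::real"] eventually_at_right_real[of 0 "1::real", OF zero_less_one]
  proof eventually_elim
    case (elim w)
    hence w: "0 < w" "w < 1" by auto
    have "(LINT y|G w. S {c..d} y) \<le> (LINT y|G w. S {a..b} y)"
      using cons G_mem[OF w] in_SI[OF w] ivl unfolding strictly_consistent_def by blast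
    thus ?case using LG[OF w] ivl by (simp add: P_def Q_def)
  qed
  moreover have "(P \<longlongrightarrow> P 0) (at_right 0)" "(Q \<longlongrightarrow> Q 0) (at_right 0)"
    unfolding P_def Q_def by (intro tendsto_intros)+
  ultimately have "Q 0 \<le> P 0"
    by (intro tendsto_le[OF trivial_limit_at_right_real])
  hence "(LINT y|Fs. S {c..d} y) \<le> (LINT y|Fs. S {a..b} y)"
    by (simp add: P_def Q_def)
  \<comment> \<open>Optimality of \<open>[a, b]\<close> under \<open>Fs\<close> gives the reverse
    inequality, and the equality clause of strict consistency applies.\<close>
  hence "{c..d} \<in> SI \<alpha> Fs"
    using cons F_mem' ab ivl unfolding strictly_consistent_def by (meson order_antisym)
  thus False using assms(7) not_ab by simp
qed

end
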